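(* Let $\mathbf{a}\in\mathbb{R}^n_+$, $\mathbf{b}\in\mathbb{R}^m_+$, and let $\mathbf{C}=(C_{ij})$ be an $n\times m$ cost matrix with entries in $\mathbb{R}\cup\{+\infty\}$. Then there exists $\gamma_0>0$ such that for every $\gamma\ge\gamma_0$ the following two minimization problems are equivalent, i.e. they have the same set of optimal triples $(\boldsymbol{\mu},\boldsymbol{\nu},\mathbf{P})$: (I) $\displaystyle \min_{(\boldsymbol{\mu},\boldsymbol{\nu})\in\mathcal{B}}\ \min_{\mathbf{P}\in\mathbf{U}(\mathbf{a}-\boldsymbol{\mu},\mathbf{b}-\boldsymbol{\nu})}\ \langle\mathbf{P},\mathbf{C}\rangle$, where $\mathcal{B}=\operatorname{argmin}_{(\boldsymbol{\mu},\boldsymbol{\nu})\in\mathcal{A}_{\mathbf{C}}}\ \big(\|\boldsymbol{\mu}\|_1+\|\boldsymbol{\nu}\|_1\big)$; (II) $\displaystyle \min_{(\boldsymbol{\mu},\boldsymbol{\nu})\in\mathcal{A}_{\mathbf{C}},\ \mathbf{P}\in\mathbf{U}(\mathbf{a}-\boldsymbol{\mu},\mathbf{b}-\boldsymbol{\nu})}\ \langle\mathbf{P},\mathbf{C}\rangle+\gamma\big(\|\boldsymbol{\mu}\|_1+\|\boldsymbol{\nu}\|_1\big)$.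
   Context: $\mathbb{R}^n_+$ denotes vectors with nonnegative entries, and $\mathbb{R}_+^{n\times m}$ matrices with nonnegative entries. $\mathbb{1}$ denotes an all-ones vector of the appropriate dimension. For nonnegative vectors $\mathbf{u}\in\mathbb{R}^n_+$, $\mathbf{v}\in\mathbb{R}^m_+$, $\mathbf{U}(\mathbf{u},\mathbf{v})=\{\mathbf{P}\in\mathbb{R}_+^{n\times m}:\mathbf{P}\mathbb{1}=\mathbf{u},\ \mathbf{P}^T\mathbb{1}=\mathbf{v}\}$ (possibly empty). $\langle\mathbf{P},\mathbf{C}\rangle=\sum_{i,j}P_{ij}C_{ij}$ with the convention $0\cdot\infty=0$, so the value is $+\infty$ as soon as $P_{ij}>0$ for some $(i,j)$ with $C_{ij}=\infty$. The set of feasible blocked marginals is $$\mathcal{A}_{\mathbf{C}}=\big\{(\boldsymbol{\mu},\boldsymbol{\nu})\in[0,\mathbf{a}]\times[0,\mathbf{b}]\ :\ \exists\,\mathbf{P}\in\mathbf{U}(\mathbf{a}-\boldsymbol{\mu},\mathbf{b}-\boldsymbol{\nu})\text{ with }\langle\mathbf{P},\mathbf{C}\rangle<\infty\big\},$$ where $(\boldsymbol{\mu},\boldsymbol{\nu})\in[0,\mathbf{a}]\times[0,\mathbf{b}]$ means $0\le\mu_i\le a_i$ for all $i$ and $0\le\nu_j\le b_j$ for all $j$. An optimal triple for (I) is a triple $(\boldsymbol{\mu},\boldsymbol{\nu},\mathbf{P})$ with $(\boldsymbol{\mu},\boldsymbol{\nu})\in\mathcal{B}$ and $\mathbf{P}\in\mathbf{U}(\mathbf{a}-\boldsymbol{\mu},\mathbf{b}-\boldsymbol{\nu})$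 attaining the overall minimum in (I). An optimal triple for (II) is a feasible triple attaining the minimum in (II). Problem (I) is the supervised optimal transport (sOT) problem. *)

theory Defs
  imports "HOL-Analysis.Analysis"
begin

text \<open>
  Vectors in \<open>real ^ 'n\<close> carry the componentwise order, so \<open>{0..a}\<close> is the box
  \<open>[0, a]\<close>, and \<open>1\<close> is the all-ones vector. An n-by-m matrix has type \<open>_ ^ 'm ^ 'n\<close>.
\<close>

definition norm1 :: "real ^ 'n \<Rightarrow> real" where
  "norm1 x = (\<Sum>i\<in>UNIV. \<bar>x $ i\<bar>)"

definition transport_plans :: "real ^ 'n \<Rightarrow> real ^ 'm \<Rightarrow> (real ^ 'm ^ 'n) set" where
  "transport_plans u v =
     {P. (\<forall>i j. 0 \<le> P $ i $ j) \<and> P *v 1 = u \<and> transpose P *v 1 = v}"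

text \<open>
  Multiplication on \<open>ereal\<close> satisfies \<open>0 * \<infinity> = 0\<close>, as required. The cost is only meant
  for matrices \<open>C\<close> without entries \<open>-\<infinity>\<close>, so that no sum \<open>\<infinity> + (-\<infinity>)\<close> occurs.
\<close>

definition transport_cost :: "real ^ 'm ^ 'n \<Rightarrow> ereal ^ 'm ^ 'n \<Rightarrow> ereal" where
  "transport_cost P C = (\<Sum>i\<in>UNIV. \<Sum>j\<in>UNIV. ereal (P $ i $ j) * C $ i $ j)"

definition feasible_blocked ::
    "real ^ 'n \<Rightarrow> real ^ 'm \<Rightarrow> ereal ^ 'm ^ 'n \<Rightarrow> ((real ^ 'n) \<times> (real ^ 'm)) set" where
  "feasible_blocked a b C =
     {(\<mu>, \<nu>) \<in> {0..a} \<times> {0..b}.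
        \<exists>P \<in> transport_plans (a - \<mu>) (b - \<nu>). transport_cost P C < \<infinity>}"

definition minimal_blocked ::
    "real ^ 'n \<Rightarrow> real ^ 'm \<Rightarrow> ereal ^ 'm ^ 'n \<Rightarrow> ((real ^ 'n) \<times> (real ^ 'm)) set" where
  "minimal_blocked a b C =
     {p. is_arg_min (\<lambda>(\<mu>, \<nu>). norm1 \<mu> + norm1 \<nu>) (\<lambda>q. q \<in> feasible_blocked a b C) p}"

definition sOT_value :: "real ^ 'n \<Rightarrow> real ^ 'm \<Rightarrow> ereal ^ 'm ^ 'n \<Rightarrow> ereal" where
  "sOT_value a b C =
     (INF (\<mu>, \<nu>) \<in> minimal_blocked a b C.
        INF P \<in> transport_plans (a - \<mu>) (b - \<nu>). transport_cost P C)"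

definition sOT_optimal ::
    "real ^ 'n \<Rightarrow> real ^ 'm \<Rightarrow> ereal ^ 'm ^ 'n
      \<Rightarrow> ((real ^ 'n) \<times> (real ^ 'm) \<times> (real ^ 'm ^ 'n)) set" where
  "sOT_optimal a b C =
     {(\<mu>, \<nu>, P). (\<mu>, \<nu>) \<in> minimal_blocked a b C \<and>
        P \<in> transport_plans (a - \<mu>) (b - \<nu>) \<and>
        transport_cost P C = sOT_value a b C}"

definition penalized_feasible ::
    "real ^ 'n \<Rightarrow> real ^ 'm \<Rightarrow> ereal ^ 'm ^ 'n
      \<Rightarrow> ((real ^ 'n) \<times> (real ^ 'm) \<times> (real ^ 'm ^ 'n)) set" where
  "penalized_feasible a b C =
     {(\<mu>, \<nu>, P). (\<mu>, \<nu>) \<in> feasible_blocked a b C \<and>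
        P \<in> transport_plans (a - \<mu>) (b - \<nu>)}"

definition penalized_objective ::
    "ereal ^ 'm ^ 'n \<Rightarrow> real \<Rightarrow> (real ^ 'n) \<times> (real ^ 'm) \<times> (real ^ 'm ^ 'n) \<Rightarrow> ereal" where
  "penalized_objective C \<gamma> =
     (\<lambda>(\<mu>, \<nu>, P). transport_cost P C + ereal (\<gamma> * (norm1 \<mu> + norm1 \<nu>)))"

definition penalized_optimal ::
    "real ^ 'n \<Rightarrow> real ^ 'm \<Rightarrow> ereal ^ 'm ^ 'n \<Rightarrow> real
      \<Rightarrow> ((real ^ 'n) \<times> (real ^ 'm) \<times> (real ^ 'm ^ 'n)) set" where
  "penalized_optimal a b C \<gamma> =
     {t. is_arg_min (penalized_objective C \<gamma>) (\<lambda>s. s \<in> penalized_feasible a b C) t}"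

end

theory Submission
  imports Defs
begin

text \<open>
  A triple of finite cost is determined by its plan \<open>P\<close>, which ranges over a nonempty polytope
  on which the cost \<open>f\<close> is linear and the blocked mass \<open>g\<close> is affine. Let \<open>g\<^sub>0\<close> be the minimum of
  \<open>g\<close>, and \<open>f\<^sub>0\<close> that of \<open>f\<close> on the face \<open>g = g\<^sub>0\<close>. As there are finitely many vertices, some
  \<open>\<gamma>\<^sub>1\<close> satisfies \<open>f\<^sub>0 \<le> f + \<gamma>\<^sub>1 (g - g\<^sub>0)\<close> at all of them, hence on the whole polytope. For
  \<open>\<gamma> > \<gamma>\<^sub>1\<close> the minimizers of \<open>f + \<gamma> g\<close> then lie on the face \<open>g = g\<^sub>0\<close>.
\<close>

section \<open>Exact penalties on polytopes\<close>

lemma polyhedron_linear_le: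
  fixes f :: "'a::euclidean_space \<Rightarrow> real"
  assumes "linear f"
  shows "polyhedron {x. f x \<le> c}"
proof -
  have "f x = adjoint f 1 \<bullet> x" for x
    using adjoint_works[OF assms, of x 1] by (simp add: inner_commute)
  then show ?thesis
    by (simp add: polyhedron_halfspace_le)
qed

text \<open>The summand \<open>g x - g x\<^sub>0\<close> in the last bound is a slack: it is
  positive off the face where \<open>g\<close> is minimal, so it excludes minimizers there. An
  affine \<open>g\<close> is covered as well, since a constant cancels in every conclusion.\<close>

lemma polytope_exact_penalty:
  fixes f g :: "'a::euclidean_space \<Rightarrow> real"
  assumes Q: "polytope Q" "Q \<noteq> {}" and f: "linear f" and g: "linear g"
  obtains x\<^sub>0 \<gamma>\<^sub>0 where "x\<^sub>0 \<in> Q" "\<gamma>\<^sub>0 > 0"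
    "\<And>x. x \<in> Q \<Longrightarrow> g x\<^sub>0 \<le> g x"
    "\<And>x. x \<in> Q \<Longrightarrow> g x = g x\<^sub>0 \<Longrightarrow> f x\<^sub>0 \<le> f x"
    "\<And>x \<gamma>. x \<in> Q \<Longrightarrow> \<gamma> \<ge> \<gamma>\<^sub>0 \<Longrightarrow> f x\<^sub>0 + \<gamma> * g x\<^sub>0 + (g x - g x\<^sub>0) \<le> f x + \<gamma> * g x"
proof -
  obtain V where V: "finite V" "Q = convex hull V"
    using Q by (auto simp: polytope_def)
  have le_on_Q: "c \<le> h x" if "linear h" "\<And>v. v \<in> V \<Longrightarrow> c \<le> h v" "x \<in> Q"
    for h :: "'a \<Rightarrow> real" and c x
  proof -
    \<comment> \<open>A half-space that contains all of \<open>V\<close> contains its convex hull,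
      so lower bounds pass from \<open>V\<close> to \<open>Q\<close>.\<close>
    have "convex {x. - h x \<le> - c}"
      by (intro polyhedron_imp_convex polyhedron_linear_le linear_compose_neg that)
    then have "convex hull V \<subseteq> {x. - h x \<le> - c}"
      using that by (intro hull_minimal) auto
    then show ?thesis
      using that V by auto
  qed
  have "V \<noteq> {}"
    using Q V by auto
  \<comment> \<open>Minimizing \<open>f\<close> over \<open>W\<close> makes \<open>x\<^sub>0\<close>
    a lexicographic minimizer of \<open>(g, f)\<close> on \<open>V\<close>.\<close>
  define W where "W = {v \<in> V. \<forall>u\<in>V. g v \<le> g u}"
  have "finite W"
    using V by (simp add: W_def)
  obtain v where "is_arg_min g (\<lambda>v. v \<in> V) v"
    using ex_is_arg_min_if_finite[OF \<open>finite V\<close> \<open>V \<noteq> {}\<close>] by blast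
  then have "W \<noteq> {}"
    by (auto simp: W_def is_arg_min_linorder)
  then obtain x\<^sub>0 where "is_arg_min f (\<lambda>v. v \<in> W) x\<^sub>0"
    using ex_is_arg_min_if_finite[OF \<open>finite W\<close>] by blast
  then have "x\<^sub>0 \<in> W" and f_W: "\<And>v. v \<in> W \<Longrightarrow> f x\<^sub>0 \<le> f v"
    by (auto simp: is_arg_min_linorder)
  then have x\<^sub>0: "x\<^sub>0 \<in> Q" and g_V: "\<And>v. v \<in> V \<Longrightarrow> g x\<^sub>0 \<le> g v"
    using V by (auto simp: W_def hull_inc)
  have g_Q: "g x\<^sub>0 \<le> g x" if "x \<in> Q" for x
    using le_on_Q[OF g] g_V that by blast
  \<comment> \<open>For \<open>g v > g x\<^sub>0\<close>, the multiplier \<open>r v\<close> suffices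
    at \<open>v\<close>; otherwise the division by zero gives 0. All values are nonnegative, so
    their sum dominates each of them.\<close>
  define r where "r v = \<bar>f x\<^sub>0 - f v\<bar> / (g v - g x\<^sub>0)" for v
  define \<gamma>\<^sub>1 where "\<gamma>\<^sub>1 = (\<Sum>v\<in>V. r v)"
  have r_nonneg: "0 \<le> r v" if "v \<in> V" for v
    using g_V[OF that] by (simp add: r_def)
  then have "0 \<le> \<gamma>\<^sub>1"
    unfolding \<gamma>\<^sub>1_def by (intro sum_nonneg)
  have vertex: "f x\<^sub>0 + \<gamma>\<^sub>1 * g x\<^sub>0 \<le> f v + \<gamma>\<^sub>1 * g v" if "v \<in> V" for v
  proof (cases "g v = g x\<^sub>0")
    case True
    then have "v \<in> W"
      using that g_V by (simp add: W_def)
    then show ?thesis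
      using f_W True by simp
  next
    case False
    then have pos: "0 < g v - g x\<^sub>0"
      using g_V[OF that] by simp
    have "r v \<le> \<gamma>\<^sub>1"
      unfolding \<gamma>\<^sub>1_def using V that r_nonneg by (intro member_le_sum) auto
    then have "\<bar>f x\<^sub>0 - f v\<bar> \<le> \<gamma>\<^sub>1 * (g v - g x\<^sub>0)"
      using pos by (simp add: r_def pos_divide_le_eq)
    then show ?thesis
      by (simp add: algebra_simps)
  qed
  have "linear (\<lambda>x. f x + \<gamma>\<^sub>1 * g x)"
    using linear_compose_add[OF f linear_compose_scale_right[OF g, of \<gamma>\<^sub>1]] by simp
  then have Q\<^sub>1: "f x\<^sub>0 + \<gamma>\<^sub>1 * g x\<^sub>0 \<le> f x + \<gamma>\<^sub>1 * g x" if "x \<in> Q" for x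
    using le_on_Q vertex that by blast
  show ?thesis
  \<comment> \<open>Raising the multiplier by 1 beyond \<open>\<gamma>\<^sub>1\<close> yields
    exactly the slack \<open>g x - g x\<^sub>0\<close>.\<close>
  proof (rule that[of x\<^sub>0 "\<gamma>\<^sub>1 + 1"])
    show "f x\<^sub>0 \<le> f x" if "x \<in> Q" "g x = g x\<^sub>0" for x
      using Q\<^sub>1[OF that(1)] that(2) by simp
    show "f x\<^sub>0 + \<gamma> * g x\<^sub>0 + (g x - g x\<^sub>0) \<le> f x + \<gamma> * g x" if "x \<in> Q" "\<gamma> \<ge> \<gamma>\<^sub>1 + 1" for x \<gamma>
    proof -
      have "(\<gamma>\<^sub>1 + 1) * (g x - g x\<^sub>0) \<le> \<gamma> * (g x - g x\<^sub>0)"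
        using g_Q[OF that(1)] that(2) by (intro mult_right_mono) auto
      then show ?thesis
        using Q\<^sub>1[OF that(1)] by (simp add: algebra_simps)
    qed
  qed (use x\<^sub>0 g_Q \<open>0 \<le> \<gamma>\<^sub>1\<close> in auto)
qed

section \<open>The polytope of finite-cost partial plans\<close>

definition partial_plans :: "real ^ 'n \<Rightarrow> real ^ 'm \<Rightarrow> ereal ^ 'm ^ 'n \<Rightarrow> (real ^ 'm ^ 'n) set" where
  "partial_plans a b C =
     {P. (\<forall>i j. 0 \<le> P $ i $ j) \<and> (\<forall>i j. C $ i $ j = \<infinity> \<longrightarrow> P $ i $ j = 0) \<and>
         (\<forall>i. (\<Sum>j\<in>UNIV. P $ i $ j) \<le> a $ i) \<and> (\<forall>j. (\<Sum>i\<in>UNIV. P $ i $ j) \<le> b $ j)}"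

text \<open>Since \<open>real_of_ereal\<close> sends \<infinity> to 0, this is a linear functional
  on all matrices. It is the true cost only where \<open>P\<close> vanishes on the infinite entries
  of \<open>C\<close>.\<close>

definition finite_cost :: "ereal ^ 'm ^ 'n \<Rightarrow> real ^ 'm ^ 'n \<Rightarrow> real" where
  "finite_cost C P = (\<Sum>i\<in>UNIV. \<Sum>j\<in>UNIV. P $ i $ j * real_of_ereal (C $ i $ j))"

definition mass :: "real ^ 'm ^ 'n \<Rightarrow> real" where
  "mass P = (\<Sum>i\<in>UNIV. \<Sum>j\<in>UNIV. P $ i $ j)"

lemma linear_finite_cost: "linear (finite_cost C)"
  by (intro linearI) (simp_all add: finite_cost_def sum.distrib sum_distrib_left algebra_simps)

lemma linear_mass: "linear mass"
  by (intro linearI) (simp_all add: mass_def sum.distrib sum_distrib_left)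

lemma bounded_partial_plans:
  fixes a :: "real ^ 'n" and b :: "real ^ 'm"
  shows "bounded (partial_plans a b C)"
proof (rule bounded_subset)
  show "bounded {0..(\<chi> i j. a $ i) :: real ^ 'm ^ 'n}"
    by (metis bounded_cbox interval_cbox)
  have "P $ i $ j \<le> a $ i" if "P \<in> partial_plans a b C" for P i j
  proof -
    have "P $ i $ j \<le> (\<Sum>j\<in>UNIV. P $ i $ j)"
      using that by (intro member_le_sum) (auto simp: partial_plans_def)
    also have "\<dots> \<le> a $ i"
      using that by (auto simp: partial_plans_def)
    finally show ?thesis .
  qed
  then show "partial_plans a b C \<subseteq> {0..(\<chi> i j. a $ i)}"
    by (auto simp: partial_plans_def less_eq_vec_def)
qed

lemma polytope_partial_plans:
  fixes a :: "real ^ 'n" and b :: "real ^ 'm"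
  shows "polytope (partial_plans a b C)"
proof -
  have lin: "linear (\<lambda>P::real ^ 'm ^ 'n. P $ i $ j)" "linear (\<lambda>P::real ^ 'm ^ 'n. - (P $ i $ j))"
    "linear (\<lambda>P::real ^ 'm ^ 'n. \<Sum>j\<in>UNIV. P $ i $ j)" "linear (\<lambda>P::real ^ 'm ^ 'n. \<Sum>i\<in>UNIV. P $ i $ j)"
    for i :: 'n and j :: 'm
    by (auto intro!: linearI simp: sum.distrib sum_distrib_left)
  \<comment> \<open>All constraints become half-spaces: at infinite entries of \<open>C\<close>, the
    equation for \<open>P\<close> splits into an upper bound and nonnegativity.\<close>
  have "partial_plans a b C =
      (\<Inter>i. \<Inter>j. {P. - (P $ i $ j) \<le> 0}) \<inter>
      (\<Inter>i. \<Inter>j\<in>{j. C $ i $ j = \<infinity>}. {P. P $ i $ j \<le> 0}) \<inter>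
      (\<Inter>i. {P. (\<Sum>j\<in>UNIV. P $ i $ j) \<le> a $ i}) \<inter>
      (\<Inter>j. {P. (\<Sum>i\<in>UNIV. P $ i $ j) \<le> b $ j})"
    by (auto simp: partial_plans_def intro: antisym)
  also have "polyhedron \<dots>"
    using polyhedron_linear_le[OF lin(2), where c = 0]
    by (auto intro!: polyhedron_Int polyhedron_Inter polyhedron_linear_le lin)
  finally show ?thesis
    by (simp add: polytope_eq_bounded_polyhedron bounded_partial_plans)
qed

section \<open>Translation between blocked marginals and partial plans\<close>

lemma transport_plans_blocked_iff:
  "P \<in> transport_plans (a - \<mu>) (b - \<nu>) \<longleftrightarrow>
    (\<forall>i j. 0 \<le> P $ i $ j) \<and> \<mu> = a - P *v 1 \<and> \<nu> = b - transpose P *v 1"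
  by (auto simp: transport_plans_def algebra_simps)

lemma transport_cost_eq_finite_cost:
  assumes "\<And>i j. C $ i $ j \<noteq> -\<infinity>" and "\<And>i j. C $ i $ j = \<infinity> \<Longrightarrow> P $ i $ j = 0"
  shows "transport_cost P C = ereal (finite_cost C P)"
proof -
  have "ereal (P $ i $ j) * C $ i $ j = ereal (P $ i $ j * real_of_ereal (C $ i $ j))" for i j
    using assms[of i j] by (cases "C $ i $ j") auto
  then show ?thesis
    by (simp add: transport_cost_def finite_cost_def)
qed

lemma transport_cost_finite_iff:
  assumes C: "\<And>i j. C $ i $ j \<noteq> -\<infinity>" and P: "\<And>i j. 0 \<le> P $ i $ j"
  shows "transport_cost P C < \<infinity> \<longleftrightarrow> (\<forall>i j. C $ i $ j = \<infinity> \<longrightarrow> P $ i $ j = 0)"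
proof
  assume "transport_cost P C < \<infinity>"
  \<comment> \<open>By nonnegativity a nonzero entry is positive, so the product is \<infinity> and
    not -\<infinity>; one such summand makes the whole sum infinite.\<close>
  moreover have "ereal (P $ i $ j) * C $ i $ j = \<infinity>" if "C $ i $ j = \<infinity>" "P $ i $ j \<noteq> 0" for i j
    using P[of i j] that by simp
  ultimately show "\<forall>i j. C $ i $ j = \<infinity> \<longrightarrow> P $ i $ j = 0"
    unfolding transport_cost_def ereal_infty_less(1) sum_Pinfty by (metis UNIV_I finite)
next
  assume "\<forall>i j. C $ i $ j = \<infinity> \<longrightarrow> P $ i $ j = 0"
  then show "transport_cost P C < \<infinity>"
    using transport_cost_eq_finite_cost[of C P] C by simp
qed

text \<open>The zero pattern in \<open>partial_plans\<close> expresses finiteness of the cost by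
  linear constraints.\<close>

lemma partial_plans_iff:
  assumes "\<And>i j. C $ i $ j \<noteq> -\<infinity>"
  shows "P \<in> partial_plans a b C \<longleftrightarrow>
    (\<forall>i j. 0 \<le> P $ i $ j) \<and> transport_cost P C < \<infinity> \<and> P *v 1 \<le> a \<and> transpose P *v 1 \<le> b"
  using transport_cost_finite_iff[of C P] assms
  by (auto simp: partial_plans_def less_eq_vec_def matrix_vector_mult_def transpose_def)

text \<open>Each transported unit is removed once from \<open>a\<close> and once from
  \<open>b\<close>, hence the factor 2; the remainders are nonnegative, so the absolute values
  disappear. Least blocked mass thus means greatest transported mass.\<close>

lemma norm1_blocked:
  assumes "P \<in> partial_plans a b C"
  shows "norm1 (a - P *v 1) + norm1 (b - transpose P *v 1) = norm1 a + norm1 b - 2 * mass P"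
proof -
  have P: "\<And>i j. 0 \<le> P $ i $ j" "\<And>i. (\<Sum>j\<in>UNIV. P $ i $ j) \<le> a $ i"
    "\<And>j. (\<Sum>i\<in>UNIV. P $ i $ j) \<le> b $ j"
    using assms by (auto simp: partial_plans_def)
  have "0 \<le> a $ i" for i
    using P(2)[of i] sum_nonneg[of UNIV "\<lambda>j. P $ i $ j"] P(1) by force
  moreover have "0 \<le> b $ j" for j
    using P(3)[of j] sum_nonneg[of UNIV "\<lambda>i. P $ i $ j"] P(1) by force
  moreover have "(\<Sum>j\<in>UNIV. \<Sum>i\<in>UNIV. P $ i $ j) = mass P"
    unfolding mass_def by (rule sum.swap)
  ultimately show ?thesis
    using P by (simp add: norm1_def matrix_vector_mult_def transpose_def sum_subtractf mass_def)
qed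

text \<open>In the box constraints, the upper bounds come from nonnegativity of \<open>P\<close> and
  the lower bounds from the marginal inequalities of a partial plan.\<close>

lemma feasible_blocked_iff:
  fixes a :: "real ^ 'n" and b :: "real ^ 'm"
  assumes "\<And>i j. C $ i $ j \<noteq> -\<infinity>"
  shows "(\<mu>, \<nu>) \<in> feasible_blocked a b C \<longleftrightarrow>
    (\<exists>P\<in>partial_plans a b C. \<mu> = a - P *v 1 \<and> \<nu> = b - transpose P *v 1)"
proof -
  have "0 \<le> P *v 1" "0 \<le> transpose P *v 1" if "\<forall>i j. 0 \<le> P $ i $ j" for P :: "real ^ 'm ^ 'n"
    using that by (auto simp: less_eq_vec_def matrix_vector_mult_def transpose_def intro!: sum_nonneg)
  then have "P \<in> partial_plans a b C \<longleftrightarrow>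
      a - P *v 1 \<in> {0..a} \<and> b - transpose P *v 1 \<in> {0..b} \<and>
      (\<forall>i j. 0 \<le> P $ i $ j) \<and> transport_cost P C < \<infinity>" for P
    unfolding partial_plans_iff[OF assms] by auto
  then show ?thesis
    by (auto simp: feasible_blocked_def transport_plans_blocked_iff Bex_def)
qed

section \<open>Equality of the two sets of optimal triples\<close>

theorem lemma2p2:
  fixes a :: "real ^ 'n" and b :: "real ^ 'm" and C :: "ereal ^ 'm ^ 'n"
  assumes "0 \<le> a" and "0 \<le> b"
    and "\<And>i j. C $ i $ j \<noteq> -\<infinity>"
  shows "\<exists>\<gamma>\<^sub>0 > 0. \<forall>\<gamma> \<ge> \<gamma>\<^sub>0. sOT_optimal a b C = penalized_optimal a b C \<gamma>"
proof -
  note C = assms(3)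
  let ?Q = "partial_plans a b C"
  let ?f = "finite_cost C"
  define blocked where "blocked P = (a - P *v 1, b - transpose P *v 1)" for P
  \<comment> \<open>Blocking everything is always possible.\<close>
  have "0 \<in> ?Q"
    using assms by (simp add: partial_plans_def less_eq_vec_def)
  then have "?Q \<noteq> {}"
    by auto
  \<comment> \<open>The blocked mass without its constant \<open>norm1 a + norm1 b\<close>.\<close>
  moreover have "linear (\<lambda>P. - 2 * mass P)"
    using linear_compose_scale_right[OF linear_mass, of "-2"] by simp
  ultimately obtain P\<^sub>0 \<gamma>\<^sub>0 where P\<^sub>0: "P\<^sub>0 \<in> ?Q" and "\<gamma>\<^sub>0 > 0"
    and mass_max: "\<And>P. P \<in> ?Q \<Longrightarrow> - 2 * mass P\<^sub>0 \<le> - 2 * mass P"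
    and cost_min: "\<And>P. P \<in> ?Q \<Longrightarrow> - 2 * mass P = - 2 * mass P\<^sub>0 \<Longrightarrow> ?f P\<^sub>0 \<le> ?f P"
    and penalty: "\<And>P \<gamma>. P \<in> ?Q \<Longrightarrow> \<gamma> \<ge> \<gamma>\<^sub>0 \<Longrightarrow>
      ?f P\<^sub>0 + \<gamma> * (- 2 * mass P\<^sub>0) + (- 2 * mass P - - 2 * mass P\<^sub>0) \<le> ?f P + \<gamma> * (- 2 * mass P)"
    using polytope_exact_penalty[OF polytope_partial_plans _ linear_finite_cost] by metis

  have cost: "transport_cost P C = ereal (?f P)" if "P \<in> ?Q" for P
    using that C by (intro transport_cost_eq_finite_cost) (auto simp: partial_plans_def)
  have feasible: "feasible_blocked a b C = blocked ` ?Q"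
    using feasible_blocked_iff[OF C, of _ _ a b] by (auto simp: blocked_def)
  \<comment> \<open>A feasible pair only has some plan of finite cost, so finiteness for this
    particular \<open>P\<close> is a separate premise.\<close>
  have plan: "P \<in> ?Q" if "P \<in> transport_plans (a - \<mu>) (b - \<nu>)"
    "(\<mu>, \<nu>) \<in> feasible_blocked a b C" "transport_cost P C < \<infinity>" for \<mu> \<nu> P
    using that C
    by (auto simp: partial_plans_iff feasible_blocked_def transport_plans_blocked_iff)
  have plan': "P \<in> transport_plans (a - \<mu>) (b - \<nu>) \<longleftrightarrow> (\<mu>, \<nu>) = blocked P"
    if "P \<in> ?Q" for P \<mu> \<nu>
    using that by (auto simp: transport_plans_blocked_iff blocked_def partial_plans_def)
  have norm: "(case blocked P of (\<mu>, \<nu>) \<Rightarrow> norm1 \<mu> + norm1 \<nu>) = norm1 a + norm1 b - 2 * mass P"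
    if "P \<in> ?Q" for P
    using norm1_blocked[OF that] by (simp add: blocked_def)

  have minimal: "blocked P \<in> minimal_blocked a b C \<longleftrightarrow> mass P = mass P\<^sub>0" if "P \<in> ?Q" for P
  proof -
    have "blocked P \<in> minimal_blocked a b C \<longleftrightarrow> (\<forall>P'\<in>?Q. mass P' \<le> mass P)"
      using that unfolding minimal_blocked_def is_arg_min_linorder feasible
      by (simp add: norm del: split_paired_All flip: Ball_def)
    also have "\<dots> \<longleftrightarrow> mass P = mass P\<^sub>0"
      using that P\<^sub>0 mass_max by (auto intro: antisym)
    finally show ?thesis .
  qed
  have minimal_feasible: "p \<in> feasible_blocked a b C" if "p \<in> minimal_blocked a b C" for p
    using that by (simp add: minimal_blocked_def is_arg_min_def)

  have value_le: "ereal (?f P\<^sub>0) \<le> transport_cost P C"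
    if "(\<mu>, \<nu>) \<in> minimal_blocked a b C" "P \<in> transport_plans (a - \<mu>) (b - \<nu>)" for \<mu> \<nu> P
  proof (cases "transport_cost P C < \<infinity>")
    case True
    then have "P \<in> ?Q"
      using plan minimal_feasible that by blast
    then show ?thesis
      using that minimal plan' cost cost_min by auto
  qed simp
  have "sOT_value a b C = ereal (?f P\<^sub>0)"
  proof (rule antisym)
    obtain \<mu> \<nu> where "(\<mu>, \<nu>) = blocked P\<^sub>0"
      by (metis surj_pair)
    then have "(\<mu>, \<nu>) \<in> minimal_blocked a b C" "P\<^sub>0 \<in> transport_plans (a - \<mu>) (b - \<nu>)"
      using P\<^sub>0 minimal plan' by auto
    then have "sOT_value a b C \<le> transport_cost P\<^sub>0 C"
      unfolding sOT_value_def by (auto intro!: INF_lower2[of "(\<mu>, \<nu>)"] INF_lower)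
    then show "sOT_value a b C \<le> ereal (?f P\<^sub>0)"
      by (simp add: cost P\<^sub>0)
    show "ereal (?f P\<^sub>0) \<le> sOT_value a b C"
      unfolding sOT_value_def using value_le by (auto intro!: INF_greatest)
  qed
  \<comment> \<open>The optimal value is finite, so an optimal plan has finite cost and
    \<open>plan\<close> puts it into \<open>?Q\<close>.\<close>
  then have sOT: "(\<mu>, \<nu>, P) \<in> sOT_optimal a b C \<longleftrightarrow>
      P \<in> ?Q \<and> (\<mu>, \<nu>) = blocked P \<and> mass P = mass P\<^sub>0 \<and> ?f P = ?f P\<^sub>0" for \<mu> \<nu> P
    using plan[of P \<mu> \<nu>] plan'[of P \<mu> \<nu>] minimal[of P] minimal_feasible[of "(\<mu>, \<nu>)"] cost[of P]
    by (auto simp: sOT_optimal_def)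

  \<comment> \<open>The right-hand side is the one found for \<open>sOT_optimal\<close> and does not
    mention \<gamma>.\<close>
  have "(\<mu>, \<nu>, P) \<in> penalized_optimal a b C \<gamma> \<longleftrightarrow>
      P \<in> ?Q \<and> (\<mu>, \<nu>) = blocked P \<and> mass P = mass P\<^sub>0 \<and> ?f P = ?f P\<^sub>0"
    if \<gamma>: "\<gamma> \<ge> \<gamma>\<^sub>0" for \<mu> \<nu> P \<gamma>
  proof -
    let ?J = "penalized_objective C \<gamma>"
    let ?F = "penalized_feasible a b C"
    let ?j = "\<lambda>P. ?f P + \<gamma> * (norm1 a + norm1 b - 2 * mass P)"
    have J: "?J (fst (blocked P), snd (blocked P), P) = ereal (?j P)" if "P \<in> ?Q" for P
      using that norm[OF that] by (simp add: penalized_objective_def cost case_prod_unfold)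
    have F: "(fst (blocked P), snd (blocked P), P) \<in> ?F" if "P \<in> ?Q" for P
      using that plan' feasible by (auto simp: penalized_feasible_def)
    have finite: "P \<in> ?Q \<and> (\<mu>, \<nu>) = blocked P"
      if "(\<mu>, \<nu>, P) \<in> ?F" "?J (\<mu>, \<nu>, P) < \<infinity>" for \<mu> \<nu> P
      using that plan[of P \<mu> \<nu>] plan'[of P \<mu> \<nu>]
      by (auto simp: penalized_feasible_def penalized_objective_def)
    \<comment> \<open>This is \<open>penalty\<close> with the constant
      \<open>\<gamma> * (norm1 a + norm1 b)\<close> added to both sides.\<close>
    have bound: "?j P\<^sub>0 + 2 * (mass P\<^sub>0 - mass P) \<le> ?j P" "mass P \<le> mass P\<^sub>0" if "P \<in> ?Q" for P
      using penalty[OF that \<gamma>] mass_max[OF that] by (simp_all add: algebra_simps)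
    have J_ge: "ereal (?j P\<^sub>0) \<le> ?J t" if "t \<in> ?F" for t
    proof (cases "?J t < \<infinity>")
      case True
      obtain \<mu> \<nu> P where t: "t = (\<mu>, \<nu>, P)"
        by (cases t)
      then have "P \<in> ?Q" "t = (fst (blocked P), snd (blocked P), P)"
        using finite[of \<mu> \<nu> P] True that by (metis fst_conv snd_conv)+
      then show ?thesis
        using J[of P] bound[of P] by simp
    qed simp
    have opt: "t \<in> penalized_optimal a b C \<gamma> \<longleftrightarrow> t \<in> ?F \<and> ?J t = ereal (?j P\<^sub>0)" for t
      unfolding penalized_optimal_def is_arg_min_linorder mem_Collect_eq
      using J_ge J[OF P\<^sub>0] F[OF P\<^sub>0] by (metis antisym)
    show ?thesis
    proof
      assume "(\<mu>, \<nu>, P) \<in> penalized_optimal a b C \<gamma>"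
      then have t: "(\<mu>, \<nu>, P) \<in> ?F" "?J (\<mu>, \<nu>, P) = ereal (?j P\<^sub>0)"
        by (simp_all only: opt)
      then have P: "P \<in> ?Q" "(\<mu>, \<nu>) = blocked P"
        using finite[of \<mu> \<nu> P] by simp_all
      then have "?j P = ?j P\<^sub>0"
        using t(2) J[OF P(1)] by (metis ereal.inject fst_conv snd_conv)
      \<comment> \<open>Equal objectives leave no room for the slack
        \<open>2 * (mass P\<^sub>0 - mass P)\<close>, so the masses agree; the penalties then cancel
        and the costs agree too.\<close>
      moreover from this have "mass P = mass P\<^sub>0"
        using bound[OF P(1)] by simp
      ultimately show "P \<in> ?Q \<and> (\<mu>, \<nu>) = blocked P \<and> mass P = mass P\<^sub>0 \<and> ?f P = ?f P\<^sub>0"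
        using P by simp
    next
      assume "P \<in> ?Q \<and> (\<mu>, \<nu>) = blocked P \<and> mass P = mass P\<^sub>0 \<and> ?f P = ?f P\<^sub>0"
      then show "(\<mu>, \<nu>, P) \<in> penalized_optimal a b C \<gamma>"
        using J[of P] F[of P] unfolding opt by (metis fst_conv snd_conv)
    qed
  qed
  then have "sOT_optimal a b C = penalized_optimal a b C \<gamma>" if "\<gamma> \<ge> \<gamma>\<^sub>0" for \<gamma>
    using that sOT by auto
  then show ?thesis
    using \<open>\<gamma>\<^sub>0 > 0\<close> by blast
qed

end
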